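(* Let $r\geq 3$ be an integer, let $n\ge 2$ be an integer, and let $\alpha$ be a real number with $(\ln n)^{-1/(r-1)}\leq\alpha\leq r^{-3}$. Let $G$ be an $r$-uniform graph with $n$ vertices and at least $\alpha n^{r}/r!$ edges. If the positive integers $s_{1},\ldots,s_{r-1}$ satisfy $1\leq s_{1}s_2\cdots s_{r-1}\leq\alpha^{r-1}\ln n$, then $G$ contains (as a subgraph) a $K_{r}(s_{1},\ldots,s_{r-1},t)$ for some integer $t>n^{1-\alpha^{r-2}}$.
   Context: An $r$-uniform graph (hypergraph) consists of a finite vertex set together with a set of edges, each edge being a subset of exactly $r$ distinct vertices. $K_{r}(s_{1},\ldots,s_{r})$ denotes the complete $r$-partite $r$-uniform graph with parts of sizes $s_{1},\ldots,s_{r}$: its vertex set is the disjoint union of sets $V_1,\dots,V_r$ with $|V_i|=s_i$, and its edges are all $r$-sets containing exactly one vertex from each $V_i$. "Contains" means as a (not necessarily induced) subgraph. $\ln$ is the natural logarithm. *)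

theory Defs
  imports Complex_Main
begin

record 'a hypergraph =
  verts :: "'a set"
  edges :: "'a set set"

definition uniform_hypergraph :: "nat \<Rightarrow> 'a hypergraph \<Rightarrow> bool" where
  "uniform_hypergraph r G \<longleftrightarrow>
     finite (verts G) \<and> (\<forall>e\<in>edges G. e \<subseteq> verts G \<and> card e = r)"

text \<open>Parts are indexed by \<open>1, \<dots>, r\<close>; only the values \<open>s 1, \<dots>, s r\<close> of the size function
  matter.  Tagging vertices with the index of their part makes the parts disjoint.\<close>

definition part :: "(nat \<Rightarrow> nat) \<Rightarrow> nat \<Rightarrow> (nat \<times> nat) set" where
  "part s i = {i} \<times> {..<s i}"

definition complete_partite :: "nat \<Rightarrow> (nat \<Rightarrow> nat) \<Rightarrow> (nat \<times> nat) hypergraph" where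
  "complete_partite r s =
     \<lparr>verts = (\<Union>i\<in>{1..r}. part s i),
      edges = {e. e \<subseteq> (\<Union>i\<in>{1..r}. part s i) \<and> card e = r \<and>
                  (\<forall>i\<in>{1..r}. card (e \<inter> part s i) = 1)}\<rparr>"

text \<open>\<open>G\<close> has a not necessarily induced subgraph isomorphic to \<open>H\<close>.\<close>

definition contains_copy :: "'a hypergraph \<Rightarrow> 'b hypergraph \<Rightarrow> bool" where
  "contains_copy G H \<longleftrightarrow>
     (\<exists>f. inj_on f (verts H) \<and> f ` verts H \<subseteq> verts G \<and> (\<forall>e\<in>edges H. f ` e \<in> edges G))"

end

theory Submission
  imports Defs "HOL-Analysis.Convex" "HOL-Combinatorics.Multiset_Permutations"
begin

text \<open>
  Instead of inducting on \<open>r\<close>, count homomorphisms. Let \<open>S = s 1 \<cdots> s (r - 1)\<close>. Iterating the power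
  mean inequality over the parts shows that a uniformly random choice of vertex tuples of lengths
  \<open>s 1, \<dots>, s (r - 1)\<close>, repetitions allowed, has on average at least \<open>\<alpha> ^ S * n\<close> vertices
  that form an edge with every transversal of the tuples. Tuples with a repeated vertex contribute at
  most \<open>\<Sum>i. (s i)\<^sup>2\<close> to this average, so some choice of repetition-free tuples has at least
  \<open>\<alpha> ^ S * n - (\<Sum>i. (s i)\<^sup>2)\<close> common neighbours. Disjointness of different parts is automatic,
  since edges have \<open>r\<close> vertices. As \<open>S \<le> \<alpha> ^ (r - 1) * ln n\<close> and \<open>- \<alpha> * ln \<alpha> \<le> 1 / 2\<close>, we have
  \<open>\<alpha> ^ S * n \<ge> n powr (1 - \<alpha> ^ (r - 2) / 2)\<close>, which leaves room for the error term because the lower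
  bound on \<open>\<alpha>\<close> forces \<open>ln n \<ge> \<alpha> powr (1 - r)\<close>.
\<close>

section \<open>Power means and the counting of tuples\<close>

text \<open>Jensen's inequality with equal weights: \<open>x ^ p\<close> is convex on the
  nonnegative reals for either parity of \<open>p\<close>.\<close>

lemma sum_power_ge_power_mean:
  fixes f :: "'b \<Rightarrow> real"
  assumes "finite A" and "\<And>x. x \<in> A \<Longrightarrow> f x \<ge> 0"
  shows "card A * ((\<Sum>x\<in>A. f x) / card A) ^ p \<le> (\<Sum>x\<in>A. f x ^ p)"
proof (cases "A = {}")
  case False
  have conv: "convex_on {0::real..} (\<lambda>x. x ^ p)"
    using convex_power_odd[of p] convex_on_subset[OF convex_power_even[of p]] by auto
  have "(\<Sum>x\<in>A. (1 / card A) *\<^sub>R f x) ^ p \<le> (\<Sum>x\<in>A. (1 / card A) * f x ^ p)"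
    using assms False by (intro convex_on_sum[OF _ _ conv]) auto
  then show ?thesis
    using assms False by (simp add: sum_divide_distrib[symmetric] field_simps card_gt_0_iff)
qed simp

text \<open>Repetitions are allowed, so that cardinalities are exact powers of
  \<open>card V\<close>; distinctness is restored later by a union bound.\<close>

definition tuples :: "'a set \<Rightarrow> nat \<Rightarrow> 'a list set" where
  "tuples V k = {xs. set xs \<subseteq> V \<and> length xs = k}"

definition box :: "'a set \<Rightarrow> nat list \<Rightarrow> 'a list list set" where
  "box V ss = {Xs. list_all2 (\<lambda>X s. X \<in> tuples V s) Xs ss}"

text \<open>Membership in \<open>set X\<close> ignores multiplicities, so a condition on all
  transversals is a conjunction over the entries of each tuple. This makes the count for a fixed
  tail a pure power.\<close>

definition transversals :: "'a list list \<Rightarrow> 'a list set" where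
  "transversals Xs = {xs. list_all2 (\<lambda>x X. x \<in> set X) xs Xs}"

lemma finite_tuples: "finite V \<Longrightarrow> finite (tuples V k)"
  by (simp add: tuples_def finite_lists_length_eq)

lemma card_tuples: "finite V \<Longrightarrow> card (tuples V k) = card V ^ k"
  by (simp add: tuples_def card_lists_length_eq)

lemma box_Nil: "box V [] = {[]}"
  by (auto simp: box_def)

lemma box_Cons: "box V (s # ss) = (\<lambda>(X, Xs). X # Xs) ` (tuples V s \<times> box V ss)"
  by (auto simp: box_def list_all2_Cons2)

lemma finite_box: "finite V \<Longrightarrow> finite (box V ss)"
  by (induction ss) (auto simp: box_Nil box_Cons finite_tuples)

lemma card_box: "finite V \<Longrightarrow> card (box V ss) = card V ^ sum_list ss"
  by (induction ss)
    (auto simp: box_Nil box_Cons card_image inj_on_def card_cartesian_product card_tuples power_add)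

lemma transversals_Nil: "transversals [] = {[]}"
  by (auto simp: transversals_def)

lemma transversals_Cons:
  "transversals (X # Xs) = (\<lambda>(x, xs). x # xs) ` (set X \<times> transversals Xs)"
  by (auto simp: transversals_def list_all2_Cons2)

text \<open>Fibring over the head, in a form that serves tuples and boxes alike.\<close>

lemma card_filter_Cons:
  assumes "finite A" "finite B"
  shows "card {z \<in> (\<lambda>(x, xs). x # xs) ` (A \<times> B). Q z} = (\<Sum>x\<in>A. card {xs \<in> B. Q (x # xs)})"
proof -
  have "{z \<in> (\<lambda>(x, xs). x # xs) ` (A \<times> B). Q z}
      = (\<lambda>(x, xs). x # xs) ` (SIGMA x:A. {xs \<in> B. Q (x # xs)})"
    by auto
  then show ?thesis
    using assms by (simp add: card_image inj_on_def)
qed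

lemma tuples_Suc: "tuples V (Suc k) = (\<lambda>(x, xs). x # xs) ` (V \<times> tuples V k)"
  by (auto simp: tuples_def length_Suc_conv)

lemma card_filter_box_Cons:
  assumes "finite V"
  shows "card {Xs \<in> box V (s # ss). Q Xs} = (\<Sum>X\<in>tuples V s. card {Xs \<in> box V ss. Q (X # Xs)})"
  unfolding box_Cons using assms by (intro card_filter_Cons finite_tuples finite_box)

lemma card_filter_tuples_Suc:
  assumes "finite V"
  shows "card {xs \<in> tuples V (Suc k). Q xs} = (\<Sum>x\<in>V. card {xs \<in> tuples V k. Q (x # xs)})"
  unfolding tuples_Suc using assms by (intro card_filter_Cons finite_tuples)

text \<open>Both sides count the pairs \<open>(x, y)\<close> that satisfy \<open>Q\<close>.\<close>

lemma sum_card_filter_swap: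
  assumes "finite A" "finite B"
  shows "(\<Sum>x\<in>A. card {y \<in> B. Q x y}) = (\<Sum>y\<in>B. card {x \<in> A. Q x y})"
  using sum.swap_restrict[OF assms, of "\<lambda>_ _. 1::nat" Q] by simp

section \<open>The blow-up inequality\<close>

text \<open>Induction over the parts with \<open>P\<close> arbitrary: fixing the tuple
  \<open>X\<close> of the first part leaves the same problem for the tails accepted by all entries
  of \<open>X\<close>. In terms of densities this is a Sidorenko-type bound for complete partite
  hypergraphs.\<close>

lemma blowup_count:
  fixes V :: "'a set"
  assumes "finite V" "V \<noteq> {}"
  shows "real (card V) ^ sum_list ss *
      (card {xs \<in> tuples V (length ss). P xs} / real (card V) ^ length ss) ^ prod_list ss
    \<le> card {Xs \<in> box V ss. \<forall>xs\<in>transversals Xs. P xs}"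
proof (induction ss arbitrary: P)
  case Nil
  have "{xs \<in> tuples V 0. P xs} = (if P [] then {[]} else {})"
    by (auto simp: tuples_def)
  moreover have "{Xs \<in> box V []. \<forall>xs\<in>transversals Xs. P xs} = (if P [] then {[]} else {})"
    by (auto simp: box_Nil transversals_Nil)
  ultimately show ?case by simp
next
  case (Cons s ss)
  define n where "n = real (card V)"
  define k where "k = length ss"
  define p where "p = prod_list ss"
  define D where "D X = real (card {xs \<in> tuples V k. \<forall>x\<in>set X. P (x # xs)})" for X
  define d where "d xs = real (card {x \<in> V. P (x # xs)})" for xs
  have n: "n > 0" using assms by (simp add: n_def card_gt_0_iff)
  have cT: "real (card (tuples V j)) = n ^ j" for j
    by (simp add: card_tuples assms n_def)
  have sumd: "(\<Sum>xs\<in>tuples V k. d xs) = card {xs \<in> tuples V (Suc k). P xs}"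
    unfolding card_filter_tuples_Suc[OF assms(1)] d_def
    using sum_card_filter_swap[OF finite_tuples[OF assms(1)] assms(1), where Q = "\<lambda>xs x. P (x # xs)"]
    by (simp flip: of_nat_sum)
  \<comment> \<open>Count compatible pairs \<open>(X, xs)\<close>: for a fixed tail
    \<open>xs\<close> the admissible \<open>X\<close> are exactly the \<open>s\<close>-tuples over
    its \<open>d xs\<close> heads.\<close>
  have "(\<Sum>X\<in>tuples V s. D X) = (\<Sum>xs\<in>tuples V k. d xs ^ s)"
  proof -
    have "{X \<in> tuples V s. \<forall>x\<in>set X. P (x # xs)} = tuples {x \<in> V. P (x # xs)} s" for xs
      by (auto simp: tuples_def)
    then have "real (card {X \<in> tuples V s. \<forall>x\<in>set X. P (x # xs)}) = d xs ^ s" for xs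
      using assms by (simp add: card_tuples d_def)
    moreover have "(\<Sum>X\<in>tuples V s. D X)
        = real (\<Sum>xs\<in>tuples V k. card {X \<in> tuples V s. \<forall>x\<in>set X. P (x # xs)})"
      using sum_card_filter_swap[OF finite_tuples finite_tuples, OF assms(1) assms(1),
          where Q = "\<lambda>X xs. \<forall>x\<in>set X. P (x # xs)"]
      unfolding D_def by (simp flip: of_nat_sum)
    ultimately show ?thesis by simp
  qed
  \<comment> \<open>First power mean, over the tails, with exponent \<open>s\<close>.\<close>
  also have "\<dots> \<ge> n ^ k * ((\<Sum>xs\<in>tuples V k. d xs) / n ^ k) ^ s"
    using sum_power_ge_power_mean[OF finite_tuples[OF assms(1)], of k d s] by (simp add: cT d_def)
  finally have sumD: "((\<Sum>xs\<in>tuples V k. d xs) / n ^ Suc k) ^ s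
      \<le> (\<Sum>X\<in>tuples V s. D X / n ^ k) / n ^ s"
    using n by (simp add: sum_divide_distrib[symmetric] field_simps)
  have "n ^ (s + sum_list ss) * ((\<Sum>xs\<in>tuples V k. d xs) / n ^ Suc k) ^ (s * p)
      \<le> n ^ sum_list ss * (n ^ s * ((\<Sum>X\<in>tuples V s. D X / n ^ k) / n ^ s) ^ p)"
  proof -
    have "0 \<le> ((\<Sum>xs\<in>tuples V k. d xs) / n ^ Suc k) ^ s"
      using n by (simp add: d_def sum_nonneg)
    then show ?thesis
      using power_mono[OF sumD, of p] n by (simp add: power_add power_mult)
  qed
  \<comment> \<open>Second power mean, over the tuples \<open>X\<close>, with exponent
    \<open>p\<close>; the two exponents multiply to \<open>s * p\<close>.\<close>
  also have "\<dots> \<le> n ^ sum_list ss * (\<Sum>X\<in>tuples V s. (D X / n ^ k) ^ p)"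
    using sum_power_ge_power_mean[OF finite_tuples[OF assms(1)], of s "\<lambda>X. D X / n ^ k" p] n
    by (simp add: cT D_def)
  \<comment> \<open>The induction hypothesis is used for each \<open>X\<close> with the predicate
    that every entry of \<open>X\<close> accepts the tail.\<close>
  also have "\<dots> \<le> (\<Sum>X\<in>tuples V s.
      real (card {Xs \<in> box V ss. \<forall>xs\<in>transversals Xs. \<forall>x\<in>set X. P (x # xs)}))"
    unfolding sum_distrib_left using Cons
    by (intro sum_mono) (simp add: D_def n_def k_def p_def)
  also have "\<dots> = card {Xs \<in> box V (s # ss). \<forall>xs\<in>transversals Xs. P xs}"
    unfolding card_filter_box_Cons[OF assms(1)] transversals_Cons by (auto intro!: sum.cong arg_cong[of _ _ card])
  finally show ?case
    unfolding sumd by (simp add: n_def k_def p_def)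
qed

section \<open>Repeated vertices and averaging\<close>

text \<open>A repetition is either new, because the head occurs in the tail, or already in the tail.
  A tail of length \<open>s\<close> contains at most \<open>s\<close> heads, and
  \<open>s + s ^ 2 \<le> (Suc s) ^ 2\<close>. The factor \<open>card V\<close> on the left avoids a
  division.\<close>

lemma card_nondistinct_tuples:
  assumes "finite V"
  shows "card V * card {X \<in> tuples V s. \<not> distinct X} \<le> s ^ 2 * card V ^ s"
proof (induction s)
  case 0
  then show ?case by (simp add: tuples_def)
next
  case (Suc s)
  let ?B = "{X \<in> tuples V s. \<not> distinct X}"
  have "card {X \<in> tuples V (Suc s). \<not> distinct X}
      \<le> (\<Sum>x\<in>V. card {X \<in> tuples V s. x \<in> set X} + card ?B)"
    unfolding card_filter_tuples_Suc[OF assms]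
  proof (intro sum_mono)
    fix x
    have "{X \<in> tuples V s. \<not> distinct (x # X)} = {X \<in> tuples V s. x \<in> set X} \<union> ?B" by auto
    then show "card {X \<in> tuples V s. \<not> distinct (x # X)} \<le> card {X \<in> tuples V s. x \<in> set X} + card ?B"
      by (simp only: card_Un_le)
  qed
  also have "\<dots> = (\<Sum>X\<in>tuples V s. card {x \<in> V. x \<in> set X}) + card V * card ?B"
    using sum_card_filter_swap[OF assms finite_tuples[OF assms], where Q = "\<lambda>x X. x \<in> set X"]
    by (simp add: sum.distrib)
  also have "\<dots> \<le> (\<Sum>X\<in>tuples V s. s) + s ^ 2 * card V ^ s"
  proof (intro add_mono Suc sum_mono)
    fix X assume "X \<in> tuples V s"
    moreover have "card {x \<in> V. x \<in> set X} \<le> card (set X)" by (intro card_mono) auto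
    ultimately show "card {x \<in> V. x \<in> set X} \<le> s"
      using card_length[of X] by (auto simp: tuples_def)
  qed
  also have "\<dots> = (s + s ^ 2) * card V ^ s"
    by (simp add: card_tuples assms algebra_simps)
  also have "\<dots> \<le> (Suc s) ^ 2 * card V ^ s"
    by (intro mult_right_mono) (auto simp: power2_eq_square)
  finally have "card V * card {X \<in> tuples V (Suc s). \<not> distinct X} \<le> card V * ((Suc s) ^ 2 * card V ^ s)"
    by (rule mult_left_mono) simp
  then show ?case by (simp add: mult_ac)
qed

text \<open>Union bound over the parts: the repetition lies in the first tuple or in a later one,
  while the remaining tuples are arbitrary.\<close>

lemma card_nondistinct_box:
  assumes "finite V"
  shows "card V * card {Xs \<in> box V ss. \<exists>X\<in>set Xs. \<not> distinct X}
    \<le> (\<Sum>s\<leftarrow>ss. s ^ 2) * card V ^ sum_list ss"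
proof (induction ss)
  case Nil
  then show ?case by (simp add: box_Nil)
next
  case (Cons s ss)
  let ?B = "{Xs \<in> box V ss. \<exists>X\<in>set Xs. \<not> distinct X}"
  have "{Xs \<in> box V (s # ss). \<exists>X\<in>set Xs. \<not> distinct X}
      \<subseteq> (\<lambda>(X, Xs). X # Xs) ` ({X \<in> tuples V s. \<not> distinct X} \<times> box V ss)
      \<union> (\<lambda>(X, Xs). X # Xs) ` (tuples V s \<times> ?B)" (is "_ \<subseteq> ?U \<union> ?W")
  proof
    fix Z assume "Z \<in> {Xs \<in> box V (s # ss). \<exists>X\<in>set Xs. \<not> distinct X}"
    then obtain X Xs where "Z = X # Xs" "X \<in> tuples V s" "Xs \<in> box V ss"
      "\<not> distinct X \<or> (\<exists>Y\<in>set Xs. \<not> distinct Y)"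
      unfolding box_Cons by (auto; metis)
    then show "Z \<in> ?U \<union> ?W" by blast
  qed
  moreover have "finite (?U \<union> ?W)"
    using assms by (simp add: finite_tuples finite_box)
  ultimately have "card {Xs \<in> box V (s # ss). \<exists>X\<in>set Xs. \<not> distinct X} \<le> card (?U \<union> ?W)"
    by (intro card_mono)
  also have "\<dots> \<le> card ?U + card ?W"
    by (rule card_Un_le)
  also have "card ?U = card {X \<in> tuples V s. \<not> distinct X} * card V ^ sum_list ss"
    by (simp add: card_image inj_on_def card_cartesian_product card_box assms)
  also have "card ?W = card V ^ s * card ?B"
    by (simp add: card_image inj_on_def card_cartesian_product card_tuples assms)
  finally have "card {Xs \<in> box V (s # ss). \<exists>X\<in>set Xs. \<not> distinct X}
      \<le> card {X \<in> tuples V s. \<not> distinct X} * card V ^ sum_list ss + card V ^ s * card ?B" .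
  then have "card V * card {Xs \<in> box V (s # ss). \<exists>X\<in>set Xs. \<not> distinct X}
      \<le> card V * (card {X \<in> tuples V s. \<not> distinct X} * card V ^ sum_list ss + card V ^ s * card ?B)"
    by (rule mult_le_mono2)
  also have "\<dots> = (card V * card {X \<in> tuples V s. \<not> distinct X}) * card V ^ sum_list ss
        + card V ^ s * (card V * card ?B)"
    by (simp add: distrib_left mult_ac)
  also have "\<dots> \<le> (s ^ 2 * card V ^ s) * card V ^ sum_list ss
        + card V ^ s * ((\<Sum>s\<leftarrow>ss. s ^ 2) * card V ^ sum_list ss)"
    using card_nondistinct_tuples[OF assms, of s] Cons
    by (intro add_mono mult_le_mono1 mult_le_mono2)
  finally show ?case by (simp add: power_add algebra_simps)
qed

text \<open>The part of the common neighbours becomes the first part, of size 1, in the count; the sum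
  over it is then exchanged with the sum over the other parts.\<close>

lemma exists_large_common_neighbourhood:
  fixes V :: "'a set" and \<alpha> \<tau> :: real
  assumes "finite V" "V \<noteq> {}" "\<alpha> \<ge> 0" "\<tau> \<ge> 0"
    and dens: "\<alpha> * real (card V) ^ Suc (length ss) \<le> card {xs \<in> tuples V (Suc (length ss)). P xs}"
    and large: "\<tau> + real (\<Sum>s\<leftarrow>ss. s ^ 2) < \<alpha> ^ prod_list ss * card V"
  obtains Xs where "Xs \<in> box V ss" "\<forall>X\<in>set Xs. distinct X"
    "\<tau> < card {v \<in> V. \<forall>xs\<in>transversals Xs. P (v # xs)}"
proof -
  define N where "N Xs = card {v \<in> V. \<forall>xs\<in>transversals Xs. P (v # xs)}" for Xs
  define n where "n = real (card V)"
  define B where "B = {Xs \<in> box V ss. \<exists>X\<in>set Xs. \<not> distinct X}"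
  have n: "n > 0" using assms by (simp add: n_def card_gt_0_iff)
  have V1: "tuples V 1 = (\<lambda>v. [v]) ` V"
    by (auto simp: tuples_def length_Suc_conv)
  have "real (card {Xs \<in> box V (1 # ss). \<forall>xs\<in>transversals Xs. P xs}) =
      (\<Sum>v\<in>V. card {Xs \<in> box V ss. \<forall>xs\<in>transversals Xs. P (v # xs)})"
    unfolding card_filter_box_Cons[OF assms(1)] V1 transversals_Cons
    by (subst sum.reindex) (auto simp: inj_on_def intro!: sum.cong arg_cong[of _ _ card])
  also have "\<dots> = (\<Sum>Xs\<in>box V ss. real (N Xs))"
    unfolding N_def
    using sum_card_filter_swap[OF assms(1) finite_box[OF assms(1)],
        where Q = "\<lambda>v Xs. \<forall>xs\<in>transversals Xs. P (v # xs)"] by simp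
  finally have total: "real (card {Xs \<in> box V (1 # ss). \<forall>xs\<in>transversals Xs. P xs})
      = (\<Sum>Xs\<in>box V ss. real (N Xs))" .
  \<comment> \<open>By \<open>dens\<close> the tuple density is at least \<open>\<alpha>\<close>.
    The extra part of size 1 adds 1 to the sum of the sizes and leaves their product
    unchanged.\<close>
  have "n ^ Suc (sum_list ss) * \<alpha> ^ prod_list ss \<le> n ^ Suc (sum_list ss) *
      (card {xs \<in> tuples V (Suc (length ss)). P xs} / n ^ Suc (length ss)) ^ prod_list ss"
    using dens n assms by (intro mult_left_mono power_mono) (auto simp: n_def field_simps)
  also have "\<dots> \<le> (\<Sum>Xs\<in>box V ss. real (N Xs))"
    using blowup_count[OF assms(1,2), of "1 # ss" P] unfolding total by (simp add: n_def)
  finally have lower: "n ^ Suc (sum_list ss) * \<alpha> ^ prod_list ss \<le> (\<Sum>Xs\<in>box V ss. real (N Xs))" .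
  \<comment> \<open>Otherwise choices with repetitions contribute at most \<open>n\<close> each and
    all others at most \<open>\<tau>\<close>, too little for the lower bound.\<close>
  have "\<exists>Xs\<in>box V ss - B. \<tau> < N Xs"
  proof (rule ccontr)
    assume "\<not> ?thesis"
    then have small: "N Xs \<le> \<tau>" if "Xs \<in> box V ss - B" for Xs
      using that by force
    have fin: "finite (box V ss)" "B \<subseteq> box V ss"
      using assms(1) by (auto simp: B_def finite_box)
    have NV: "N Xs \<le> card V" for Xs
      unfolding N_def using assms(1) by (intro card_mono) auto
    have "(\<Sum>Xs\<in>box V ss. real (N Xs)) = (\<Sum>Xs\<in>B. real (N Xs)) + (\<Sum>Xs\<in>box V ss - B. real (N Xs))"
      using fin by (metis add.commute sum.subset_diff)
    also have "\<dots> \<le> (\<Sum>Xs\<in>B. n) + (\<Sum>Xs\<in>box V ss - B. \<tau>)"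
      using small NV by (intro add_mono sum_mono) (auto simp: n_def)
    also have "\<dots> \<le> n * card B + card (box V ss) * \<tau>"
      using assms(4) fin by (auto intro!: mult_right_mono card_mono)
    \<comment> \<open>The trivial bound \<open>n\<close> per bad choice is the factor
      \<open>card V\<close> in \<open>card_nondistinct_box\<close>.\<close>
    also have "\<dots> \<le> real (\<Sum>s\<leftarrow>ss. s ^ 2) * n ^ sum_list ss + n ^ sum_list ss * \<tau>"
      using of_nat_mono[OF card_nondistinct_box[OF assms(1), of ss], where 'a = real]
      by (simp add: card_box assms(1) n_def B_def)
    also have "\<dots> = n ^ sum_list ss * (\<tau> + real (\<Sum>s\<leftarrow>ss. s ^ 2))"
      by (simp add: algebra_simps)
    also have "\<dots> < n ^ sum_list ss * (\<alpha> ^ prod_list ss * n)"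
      using large n by (intro mult_strict_left_mono) (auto simp: n_def)
    finally show False
      using lower by (simp add: algebra_simps)
  qed
  then show ?thesis
    using that unfolding B_def N_def by blast
qed

section \<open>From edges to tuples and from tuples to an embedding\<close>

text \<open>Each edge has \<open>fact r\<close> orderings, so the assumed number of edges becomes
  tuple density \<open>\<alpha>\<close>.\<close>

lemma card_tuples_of_edges:
  assumes "uniform_hypergraph r G"
  shows "card {xs \<in> tuples (verts G) r. set xs \<in> edges G} = fact r * card (edges G)"
proof -
  have G: "finite (verts G)" "\<And>e. e \<in> edges G \<Longrightarrow> e \<subseteq> verts G \<and> card e = r"
    using assms by (auto simp: uniform_hypergraph_def)
  then have fin: "finite e" if "e \<in> edges G" for e
    using that finite_subset by blast
  have finE: "finite (edges G)"
    using G by (intro finite_subset[of "edges G" "Pow (verts G)"]) auto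
  \<comment> \<open>A list of length \<open>r\<close> whose set has \<open>r\<close> elements has no
    repetition, so it is a permutation of its edge.\<close>
  have "{xs \<in> tuples (verts G) r. set xs \<in> edges G} = (\<Union>e\<in>edges G. permutations_of_set e)"
    using G distinct_card by (fastforce simp: tuples_def permutations_of_set_def card_distinct)
  also have "card \<dots> = (\<Sum>e\<in>edges G. card (permutations_of_set e))"
    using finE finite_permutations_of_set
    by (intro card_UN_disjoint) (auto dest: permutations_of_setD)
  also have "\<dots> = (\<Sum>e\<in>edges G. fact r)"
    using G fin by (intro sum.cong) auto
  finally show ?thesis by simp
qed

text \<open>Part \<open>i < r\<close> goes to the entries of the \<open>i\<close>-th tuple and part
  \<open>r\<close> to \<open>T\<close>. Injectivity within a tuple is its distinctness; images of
  different parts are disjoint because edges have \<open>r\<close> elements.\<close>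

lemma contains_copy_complete_partiteI:
  fixes G :: "'a hypergraph"
  assumes unif: "uniform_hypergraph r G" and "r \<ge> 1"
    and Xs: "Xs \<in> box (verts G) (map s [1..<r])" "\<forall>X\<in>set Xs. distinct X"
    and spos: "\<And>i. i \<in> {1..<r} \<Longrightarrow> s i > 0"
    and T: "T \<subseteq> verts G" "T \<noteq> {}"
    and edge: "\<And>v xs. v \<in> T \<Longrightarrow> xs \<in> transversals Xs \<Longrightarrow> set (v # xs) \<in> edges G"
  shows "contains_copy G (complete_partite r (s(r := card T)))"
proof -
  define u where "u = s(r := card T)"
  have finT: "finite T" using T unif finite_subset by (auto simp: uniform_hypergraph_def)
  obtain g where g: "bij_betw g {0..<card T} T"
    using ex_bij_betw_nat_finite[OF finT] by blast
  \<comment> \<open>Parts are numbered from 1 and list positions from 0, hence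
    \<open>i - 1\<close>.\<close>
  define f where "f = (\<lambda>(i, j). if i = r then g j else Xs ! (i - 1) ! j)"
  have lenXs: "length Xs = r - 1"
    using Xs by (auto simp: box_def dest: list_all2_lengthD)
  have Xi: "length (Xs ! (i - 1)) = s i" "set (Xs ! (i - 1)) \<subseteq> verts G" "distinct (Xs ! (i - 1))"
    if "i \<in> {1..<r}" for i
  proof -
    have "Xs ! (i - 1) \<in> tuples (verts G) (map s [1..<r] ! (i - 1))"
      using Xs(1) that list_all2_nthD2[of "\<lambda>X k. X \<in> tuples (verts G) k" Xs "map s [1..<r]" "i - 1"]
      by (auto simp: box_def)
    moreover have "map s [1..<r] ! (i - 1) = s i"
      using that by auto
    ultimately show "length (Xs ! (i - 1)) = s i" "set (Xs ! (i - 1)) \<subseteq> verts G"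
      by (auto simp: tuples_def)
    show "distinct (Xs ! (i - 1))"
      using Xs(2) that lenXs by (auto intro!: nth_mem)
  qed
  have upos: "u i > 0" if "i \<in> {1..r}" for i
    using that spos T finT by (auto simp: u_def card_gt_0_iff)
  have trans_edge: "(\<lambda>i. f (i, c i)) ` {1..r} \<in> edges G" if c: "\<And>i. i \<in> {1..r} \<Longrightarrow> c i < u i" for c
  proof -
    \<comment> \<open>Part \<open>r\<close> is last in the numbering but supplies the head of the
      list, as \<open>edge\<close> expects.\<close>
    let ?xs = "map (\<lambda>i. f (i, c i)) [1..<r]"
    have "f (r, c r) \<in> T"
      using c[of r] g \<open>r \<ge> 1\<close> by (auto simp: f_def u_def bij_betw_def)
    moreover have "?xs \<in> transversals Xs"
    proof -
      have "f (Suc k, c (Suc k)) \<in> set (Xs ! k)" if "k < r - 1" for k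
        using that c[of "Suc k"] Xi(1)[of "Suc k"] by (auto simp: f_def u_def)
      then show ?thesis
        by (simp add: transversals_def list_all2_conv_all_nth lenXs)
    qed
    ultimately have "set (f (r, c r) # ?xs) \<in> edges G"
      by (rule edge)
    moreover have "set (f (r, c r) # ?xs) = (\<lambda>i. f (i, c i)) ` {1..r}"
    proof -
      have "{1..r} = insert r {1..<r}" using \<open>r \<ge> 1\<close> by auto
      then show ?thesis by simp
    qed
    ultimately show ?thesis by simp
  qed
  have vH: "verts (complete_partite r u) = {(i, j). i \<in> {1..r} \<and> j < u i}"
    by (auto simp: complete_partite_def Defs.part_def)
  have "inj_on f (verts (complete_partite r u))"
  proof (rule inj_onI)
    fix p q assume "p \<in> verts (complete_partite r u)" "q \<in> verts (complete_partite r u)" "f p = f q"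
    moreover obtain i j i' j' where pq: "p = (i, j)" "q = (i', j')" by (cases p; cases q)
    ultimately have i: "i \<in> {1..r}" "j < u i" "i' \<in> {1..r}" "j' < u i'" and eq: "f (i, j) = f (i', j')"
      by (auto simp: vH)
    have "i = i'"
    proof (rule ccontr)
      assume "i \<noteq> i'"
      \<comment> \<open>An edge through both vertices; every other part uses its vertex 0, which
        exists since all parts are nonempty.\<close>
      define c where "c = (\<lambda>_. 0::nat)(i := j, i' := j')"
      have "(\<lambda>k. f (k, c k)) ` {1..r} \<in> edges G"
        using upos i by (intro trans_edge) (auto simp: c_def)
      then have "card ((\<lambda>k. f (k, c k)) ` {1..r}) = card {1..r}"
        using unif by (auto simp: uniform_hypergraph_def)
      then have "inj_on (\<lambda>k. f (k, c k)) {1..r}"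
        by (intro eq_card_imp_inj_on) auto
      then show False
        using inj_onD[of "\<lambda>k. f (k, c k)" "{1..r}" i i'] i eq \<open>i \<noteq> i'\<close>
        by (simp add: c_def)
    qed
    moreover have "j = j'"
    proof (cases "i = r")
      case True
      then show ?thesis
        using eq i g \<open>i = i'\<close> by (auto simp: f_def u_def bij_betw_def inj_on_def)
    next
      case False
      then have "i \<in> {1..<r}" using i by auto
      then show ?thesis
        using eq i Xi[of i] \<open>i = i'\<close> False by (auto simp: f_def u_def nth_eq_iff_index_eq)
    qed
    ultimately show "p = q" by (simp add: pq)
  qed
  moreover have "f ` verts (complete_partite r u) \<subseteq> verts G"
  proof (rule image_subsetI)
    fix p assume "p \<in> verts (complete_partite r u)"
    then obtain i j where p: "p = (i, j)" and ij: "i \<in> {1..r}" "j < u i"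
      by (auto simp: vH)
    \<comment> \<open>The image of the vertex lies on an edge of \<open>G\<close>, hence in
      \<open>verts G\<close>.\<close>
    define c where "c = (\<lambda>_. 0::nat)(i := j)"
    have "(\<lambda>k. f (k, c k)) ` {1..r} \<in> edges G"
      using ij upos by (intro trans_edge) (auto simp: c_def)
    then have "(\<lambda>k. f (k, c k)) ` {1..r} \<subseteq> verts G"
      using unif by (simp add: uniform_hypergraph_def)
    then have "f (i, c i) \<in> verts G"
      using ij(1) by (simp only: image_subset_iff)
    then show "f p \<in> verts G" by (simp add: p c_def)
  qed
  moreover have "f ` e \<in> edges G" if e: "e \<in> edges (complete_partite r u)" for e
  proof -
    have sub: "e \<subseteq> (\<Union>i\<in>{1..r}. Defs.part u i)" and one: "\<And>i. i \<in> {1..r} \<Longrightarrow> card (e \<inter> Defs.part u i) = 1"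
      using e by (auto simp: complete_partite_def)
    \<comment> \<open>An edge meets every part exactly once, so it is the graph of a choice function
      \<open>c\<close>.\<close>
    have "\<exists>j. e \<inter> Defs.part u i = {(i, j)} \<and> j < u i" if i: "i \<in> {1..r}" for i
    proof -
      obtain p where p: "e \<inter> Defs.part u i = {p}"
        using one[OF i] card_1_singletonE by blast
      then have "p \<in> Defs.part u i" by blast
      then show ?thesis using p by (auto simp: Defs.part_def)
    qed
    then obtain c where c: "\<And>i. i \<in> {1..r} \<Longrightarrow> e \<inter> Defs.part u i = {(i, c i)} \<and> c i < u i"
      by metis
    have "e = (\<Union>i\<in>{1..r}. e \<inter> Defs.part u i)" using sub by blast
    also have "\<dots> = (\<lambda>i. (i, c i)) ` {1..r}" using c by auto
    finally have "f ` e = (\<lambda>i. f (i, c i)) ` {1..r}" by (simp add: image_image)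
    then show ?thesis using trans_edge c by simp
  qed
  ultimately show ?thesis
    unfolding contains_copy_def u_def by blast
qed

section \<open>Numerical estimates\<close>

text \<open>Apply \<open>ln y \<le> y - 1\<close> at \<open>2\<close> and at
  \<open>1 / (2 * x)\<close>; splitting off \<open>ln 2\<close> makes the constants cancel.\<close>

lemma mult_neg_ln_le_half:
  fixes x :: real
  assumes "x > 0"
  shows "x * (- ln x) \<le> 1 / 2"
proof -
  have "- ln x = ln 2 + ln (1 / (2 * x))"
    using assms by (simp add: ln_div ln_mult)
  also have "\<dots> \<le> 1 + (1 / (2 * x) - 1)"
    using assms ln_le_minus_one[of "1 / (2 * x)"] ln_le_minus_one[of "2::real"] by (intro add_mono) auto
  finally have "x * (- ln x) \<le> x * (1 / (2 * x))"
    using assms by (intro mult_left_mono) auto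
  then show ?thesis using assms by simp
qed

text \<open>With \<open>L = ln n\<close> and \<open>a = \<alpha> ^ (r - 2)\<close> the right side is
  at least \<open>2 * exp (L - a * L)\<close>. One copy is the power of \<open>n\<close> on the
  left; the other exceeds the error term, which is at most quadratic in \<open>L\<close>.\<close>

lemma size_estimate:
  fixes r n S :: nat and \<alpha> :: real
  assumes r: "r \<ge> 3" and n: "n \<ge> 2"
    and lo: "ln (real n) powr (- 1 / (real r - 1)) \<le> \<alpha>" and hi: "\<alpha> \<le> real r powr (- 3)"
    and S: "real S \<le> \<alpha> ^ (r - 1) * ln (real n)"
  shows "real n powr (1 - \<alpha> ^ (r - 2)) + real (r - 1) * real S ^ 2 < \<alpha> ^ S * real n"
proof -
  define L where "L = ln (real n)"
  define a where "a = \<alpha> ^ (r - 2)"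
  have L: "L > 0" using n by (simp add: L_def)
  have \<alpha>0: "\<alpha> > 0" using lo L by (smt (verit) L_def powr_gt_zero)
  have r3: "real r powr (- 3) = 1 / real r ^ 3"
    using r by (simp add: powr_minus divide_simps powr_realpow)
  have "(3::real) ^ 3 \<le> real r ^ 3" using r by (intro power_mono) auto
  then have "1 / real r ^ 3 \<le> 1 / 27" by (intro frac_le) auto
  then have \<alpha>27: "\<alpha> \<le> 1 / 27" using hi r3 by simp
  \<comment> \<open>The resulting bound \<open>r * \<alpha> \<le> 1\<close> absorbs the factor
    \<open>r - 1\<close> of the error term.\<close>
  have "real r ^ 1 \<le> real r ^ 3" using r by (intro power_increasing) auto
  then have "1 / real r ^ 3 \<le> 1 / real r" using r by (intro frac_le) auto
  then have "real r * \<alpha> \<le> real r * (1 / real r)"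
    using hi r3 by (intro mult_left_mono) auto
  then have r\<alpha>: "real r * \<alpha> \<le> 1" using r by simp
  have \<alpha>a: "\<alpha> ^ (r - 1) = \<alpha> * a"
    using r by (simp add: a_def Suc_diff_Suc numeral_2_eq_2 flip: power_Suc)
  \<comment> \<open>Raised to the power \<open>r - 1\<close>, the lower bound on
    \<open>\<alpha>\<close> reads \<open>1 / L \<le> \<alpha> ^ (r - 1)\<close>.\<close>
  have "(L powr (- 1 / (real r - 1))) ^ (r - 1) = (L powr (- 1 / (real r - 1))) powr (real r - 1)"
    using r L by (subst powr_realpow[symmetric]) auto
  also have "\<dots> = L powr (- 1)"
    using r by (simp only: powr_powr) simp
  finally have "inverse L = (L powr (- 1 / (real r - 1))) ^ (r - 1)"
    using L by (simp add: powr_minus)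
  also have "\<dots> \<le> \<alpha> ^ (r - 1)"
    using lo by (intro power_mono) (auto simp: L_def)
  finally have \<alpha>aL: "\<alpha> * a * L \<ge> 1"
    using L unfolding \<alpha>a by (simp add: field_simps)
  have a0: "a > 0" using \<alpha>0 by (simp add: a_def)
  have "\<alpha> ^ (r - 2) \<le> \<alpha> ^ 1"
    using \<alpha>0 \<alpha>27 r by (intro power_decreasing) auto
  then have a\<alpha>: "a \<le> \<alpha>" by (simp add: a_def)
  have aL: "a * L \<ge> 27"
  proof -
    have "\<alpha> * (a * L) \<le> (1 / 27) * (a * L)"
      using \<alpha>27 a0 L by (intro mult_right_mono) auto
    then show ?thesis using \<alpha>aL by (simp add: mult.assoc)
  qed
  have S': "real S \<le> \<alpha> * a * L" using S unfolding L_def \<alpha>a .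
  have pow: "\<alpha> ^ S * real n \<ge> exp (L - a * L) * 2"
  proof -
    \<comment> \<open>Only half of \<open>a * L\<close> is spent on \<open>\<alpha> ^ S\<close>; the
      other half yields the factor 2.\<close>
    have "real S * (- ln \<alpha>) \<le> \<alpha> * a * L * (- ln \<alpha>)"
      using S' \<alpha>0 \<alpha>27 by (intro mult_right_mono) auto
    also have "\<dots> = (\<alpha> * (- ln \<alpha>)) * (a * L)" by simp
    also have "\<dots> \<le> 1 / 2 * (a * L)"
      using mult_neg_ln_le_half[OF \<alpha>0] a0 L by (intro mult_right_mono) auto
    finally have "L - a * L + a * L / 2 \<le> real S * ln \<alpha> + L"
      by (simp add: field_simps)
    then have "exp (L - a * L) * exp (a * L / 2) \<le> exp (real S * ln \<alpha> + L)"
      by (simp flip: exp_add)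
    also have "\<dots> = \<alpha> ^ S * real n"
      using \<alpha>0 n by (simp add: exp_add exp_of_nat_mult L_def)
    finally have "exp (L - a * L) * exp (a * L / 2) \<le> \<alpha> ^ S * real n" .
    moreover have "exp (a * L / 2) \<ge> 2"
      using exp_ge_add_one_self[of "a * L / 2"] aL by linarith
    then have "exp (L - a * L) * 2 \<le> exp (L - a * L) * exp (a * L / 2)"
      by (intro mult_left_mono) auto
    ultimately show ?thesis by linarith
  qed
  \<comment> \<open>The target \<open>L ^ 2 / 8\<close> is the quadratic Taylor term of
    \<open>exp (L / 2)\<close>.\<close>
  have "real (r - 1) * real S ^ 2 \<le> L ^ 2 / 8"
  proof -
    have "\<alpha> * a * L \<le> \<alpha> * \<alpha> * L"
      using a\<alpha> \<alpha>0 L by (intro mult_right_mono mult_left_mono) auto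
    then have "real S ^ 2 \<le> (\<alpha> * \<alpha> * L) ^ 2"
      using S' by (intro power_mono) auto
    then have "real (r - 1) * real S ^ 2 \<le> real r * (\<alpha> * \<alpha> * L) ^ 2"
      by (intro mult_mono) auto
    also have "\<dots> = (real r * \<alpha>) * \<alpha> ^ 3 * L ^ 2"
      by (simp add: power2_eq_square power3_eq_cube)
    also have "\<dots> \<le> 1 * (1 / 27) ^ 3 * L ^ 2"
      using r\<alpha> \<alpha>0 \<alpha>27 L by (intro mult_mono power_mono) auto
    also have "\<dots> \<le> L ^ 2 / 8" by (simp add: power3_eq_cube)
    finally show ?thesis .
  qed
  also have "\<dots> < 1 + L / 2 + (L / 2) ^ 2 / 2"
    using L by (simp add: power_divide)
  also have "\<dots> \<le> exp (L / 2)"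
    using L by (intro exp_lower_Taylor_quadratic) auto
  also have "\<dots> \<le> exp (L - a * L)"
  proof -
    have "a * L \<le> 1 / 2 * L"
      using a\<alpha> \<alpha>27 L by (intro mult_right_mono) auto
    then show ?thesis by simp
  qed
  finally have "real (r - 1) * real S ^ 2 < exp (L - a * L)" .
  moreover have "real n powr (1 - a) = exp (L - a * L)"
    using n by (simp add: powr_def L_def algebra_simps)
  ultimately show ?thesis
    using pow by (simp add: a_def)
qed

section \<open>Combination of counting, estimate and embedding\<close>

theorem theorem2:
  fixes r n :: nat and \<alpha> :: real and G :: "'a hypergraph" and s :: "nat \<Rightarrow> nat"
  assumes "r \<ge> 3" and "n \<ge> 2"
    and "ln (real n) powr (- 1 / (real r - 1)) \<le> \<alpha>" and "\<alpha> \<le> real r powr (- 3)"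
    and "uniform_hypergraph r G" and "card (verts G) = n"
    and "real (card (edges G)) \<ge> \<alpha> * real n ^ r / fact r"
    and "\<forall>i\<in>{1..r - 1}. s i > 0"
    and "1 \<le> (\<Prod>i=1..r - 1. s i)"
    and "real (\<Prod>i=1..r - 1. s i) \<le> \<alpha> ^ (r - 1) * ln (real n)"
  shows "\<exists>t::nat. real t > real n powr (1 - \<alpha> ^ (r - 2)) \<and>
           contains_copy G (complete_partite r (s(r := t)))"
proof -
  define S where "S = (\<Prod>i=1..r - 1. s i)"
  define ss where "ss = map s [1..<r]"
  define \<tau> where "\<tau> = real n powr (1 - \<alpha> ^ (r - 2))"
  have fin: "finite (verts G)" using assms(5) by (simp add: uniform_hypergraph_def)
  have ne: "verts G \<noteq> {}" using assms(2,6) by auto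
  have \<alpha>0: "\<alpha> \<ge> 0" using assms(3) by (smt (verit) powr_ge_zero)
  have len: "Suc (length ss) = r" using assms(1) by (simp add: ss_def)
  have atl: "{1..r - 1} = {1..<r}" using assms(1) by auto
  have prod: "prod_list ss = S"
    unfolding ss_def S_def atl using prod.distinct_set_conv_list[of "[1..<r]" s] by simp
  have "(\<Sum>k\<leftarrow>ss. k ^ 2) = (\<Sum>i\<in>{1..<r}. s i ^ 2)"
    using sum.distinct_set_conv_list[of "[1..<r]" "\<lambda>i. s i ^ 2"] by (simp add: ss_def o_def)
  \<comment> \<open>Each \<open>s i\<close> divides the positive product \<open>S\<close>, hence is
    at most \<open>S\<close>.\<close>
  also have "\<dots> \<le> (\<Sum>i\<in>{1..<r}. S ^ 2)"
  proof (intro sum_mono power_mono)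
    fix i assume i: "i \<in> {1..<r}"
    have "s i dvd S" unfolding S_def atl using i by (intro dvd_prodI) auto
    then show "s i \<le> S" using assms(9) unfolding S_def by (intro dvd_imp_le) linarith+
  qed simp
  finally have squares: "real (\<Sum>k\<leftarrow>ss. k ^ 2) \<le> real (r - 1) * real S ^ 2"
    using of_nat_mono[where 'a = real] by fastforce
  have large: "\<tau> + real (\<Sum>k\<leftarrow>ss. k ^ 2) < \<alpha> ^ prod_list ss * card (verts G)"
    using size_estimate[OF assms(1-4), of S] assms(10) squares
    by (simp add: prod \<tau>_def S_def assms(6))
  have dens: "\<alpha> * real (card (verts G)) ^ Suc (length ss)
      \<le> card {xs \<in> tuples (verts G) (Suc (length ss)). set xs \<in> edges G}"
    using assms(7) unfolding len card_tuples_of_edges[OF assms(5)]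
    by (simp add: assms(6) field_simps)
  obtain Xs where Xs: "Xs \<in> box (verts G) ss" "\<forall>X\<in>set Xs. distinct X"
    "\<tau> < card {v \<in> verts G. \<forall>xs\<in>transversals Xs. set (v # xs) \<in> edges G}"
    using exists_large_common_neighbourhood[OF fin ne \<alpha>0 _ dens large] by (auto simp: \<tau>_def)
  define T where "T = {v \<in> verts G. \<forall>xs\<in>transversals Xs. set (v # xs) \<in> edges G}"
  have T: "\<tau> < card T" using Xs(3) by (simp add: T_def)
  \<comment> \<open>As \<open>\<tau>\<close> is nonnegative, \<open>card T\<close> is
    positive.\<close>
  then have "T \<noteq> {}" by (auto simp: \<tau>_def)
  then have "contains_copy G (complete_partite r (s(r := card T)))"
    using assms(1,5,8) Xs(1,2)
    by (intro contains_copy_complete_partiteI[of r G Xs s T]) (auto simp: ss_def T_def atl)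
  then show ?thesis
    using T unfolding \<tau>_def by blast
qed

end
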